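(* Assume the explicit abc conjecture: whenever $a,b,c$ are pairwise coprime non-zero integers with $a+b=c$, one has $c<N(abc)^{7/4}$, where $N(x)=\prod_{p\mid x}p$ denotes the product of the distinct primes dividing $x$. Let $t\geq 3$ be an integer and let $c>0$ be a fixed positive integer. Consider tuples of integers $(a_1,\dots,a_t,n_1,n_2)$ with $a_1\geq a_2\geq\cdots\geq a_t\geq 2$, $n_1\geq n_2\geq 2$ and $a_l\neq n_j$ for all $l,j$, satisfying $$\prod_{l=1}^t a_l! = n_1!\,n_2!.$$ Such a solution is called trivial if there is a pair $(l,j)$ with $|a_l-n_j|=1$, and nontrivial otherwise. For $2\leq i\leq t$ let $\mathcal{N}(c)_i$ be the set of nontrivial solutions with $n_1>a_1$, $n_2>a_i$ and $k_2/k_1\leq c$, where $k_1=n_1-a_1$ and $k_2=n_2-a_i$. (For such solutions, with $m_1=a_1+1$, $m_2=a_i+1$ and $\Delta(m,k)=m(m+1)\cdots(m+k-1)$, the equation is equivalent to $\prod_{l\neq 1,i}a_l!=\Delta(m_1,k_1)\Delta(m_2,k_2)$.) Then for every $2\leq i\leq t$ the set $\mathcal{N}(c)_i$ is finite. Consequently, the set $\mathcal{N}(c)=\bigcup_{i=2}^t\mathcal{N}(c)_i$ is finite, i.e. the equation $\prod_{l=1}^t a_l!=n_1!n_2!$ has only finitely many solutions in $\mathcal{N}(c)$.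
   Context: $N(x)$ denotes the algebraic radical of a non-zero integer $x$, i.e. the product of the distinct primes dividing $x$. The "explicit abc conjecture" is the hypothesis stated at the beginning of the claim. *)

theory Defs
  imports "HOL-Computational_Algebra.Primes" Complex_Main
begin

definition rad :: "int \<Rightarrow> int" where
  "rad x = (\<Prod>p\<in>prime_factors x. p)"

definition explicit_abc :: bool where
  "explicit_abc \<longleftrightarrow>
     (\<forall>a b c :: int. a \<noteq> 0 \<and> b \<noteq> 0 \<and> c \<noteq> 0 \<and>
        coprime a b \<and> coprime a c \<and> coprime b c \<and> a + b = c \<longrightarrow>
        real_of_int c < (real_of_int (rad (a * b * c))) powr (7 / 4))"

(* a tuple (a_1,...,a_t) is the list a, with a_l = a ! (l - 1) *)
definition is_solution :: "nat \<Rightarrow> nat list \<Rightarrow> nat \<Rightarrow> nat \<Rightarrow> bool" where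
  "is_solution t a n1 n2 \<longleftrightarrow>
     length a = t \<and>
     (\<forall>l. 1 \<le> l \<and> l < t \<longrightarrow> a ! (l - 1) \<ge> a ! l) \<and>
     a ! (t - 1) \<ge> 2 \<and>
     n1 \<ge> n2 \<and> n2 \<ge> 2 \<and>
     (\<forall>l<t. a ! l \<noteq> n1 \<and> a ! l \<noteq> n2) \<and>
     (\<Prod>l<t. fact (a ! l)) = (fact n1 * fact n2 :: nat)"

definition nontrivial :: "nat \<Rightarrow> nat list \<Rightarrow> nat \<Rightarrow> nat \<Rightarrow> bool" where
  "nontrivial t a n1 n2 \<longleftrightarrow>
     (\<forall>l<t. \<forall>n\<in>{n1, n2}. \<bar>int (a ! l) - int n\<bar> \<noteq> 1)"

definition Nset :: "nat \<Rightarrow> nat \<Rightarrow> nat \<Rightarrow> (nat list \<times> nat \<times> nat) set" where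
  "Nset t c i = {(a, n1, n2). is_solution t a n1 n2 \<and> nontrivial t a n1 n2 \<and>
      n1 > a ! 0 \<and> n2 > a ! (i - 1) \<and>
      real (n2 - a ! (i - 1)) / real (n1 - a ! 0) \<le> real c}"

end

theory Submission
  imports Defs "HOL-Real_Asymp.Real_Asymp"
begin

text \<open>
  Write \<open>n = n\<^sub>1\<close>, \<open>k = n\<^sub>1 - a\<^sub>1\<close>, and let \<open>A\<close> be the largest \<open>a\<^sub>l\<close> with \<open>l \<noteq> 1, i\<close>. After cancelling
  \<open>a\<^sub>1!\<close> and \<open>a\<^sub>i!\<close> in the equation, the \<open>k \<ge> 2\<close> integers in \<open>(n - k, n]\<close> have no prime factor above \<open>A\<close>,
  and \<open>A! \<le> n\<^bsup>(1 + c) k\<^esup>\<close>.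

  Prime gaps are not needed to see that \<open>k\<close> is small. The 2-adic valuation of the equation gives
  \<open>\<Sum> a\<^sub>l \<le> n\<^sub>1 + n\<^sub>2 + O(log n)\<close>. As all \<open>a\<^sub>l \<le> n - k\<close>, log-convexity of the factorial would make
  \<open>\<Prod> a\<^sub>l!\<close> smaller than \<open>n\<^sub>1! n\<^sub>2!\<close> unless \<open>k\<^sup>2 = O(n log\<^sup>2 n)\<close>.
  Since prime powers dividing a binomial coefficient \<open>n choose k\<close> are at most \<open>n\<close>, we get
  \<open>(n / k)\<^bsup>k\<^esup> \<le> (n choose k) \<le> n\<^bsup>\<pi>(A)\<^esup>\<close>, so \<open>k \<le> 4 \<pi>(A) = o(A)\<close>. Together with the upper bound for
  \<open>A!\<close> this forces \<open>log A = o(log n)\<close>, hence \<open>k \<le> n\<^bsup>1/32\<^esup>\<close>.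

  Now apply abc to the \<open>\<lfloor>k / 2\<rfloor>\<close> disjoint pairs of neighbours in \<open>(n - k, n]\<close> and multiply. The product of the
  radicals of \<open>k\<close> consecutive \<open>A\<close>-smooth integers is at most \<open>k! 4\<^bsup>A\<^esup>\<close>, so \<open>k log n = O(A)\<close>. Then
  \<open>A log A = O(log A!) = O(k log n) = O(A)\<close> bounds \<open>A\<close>, and therefore \<open>n\<close>.
\<close>

subsection \<open>The 2-adic valuation of factorials\<close>

lemma multiplicity_two_fact_double:
  "multiplicity 2 (fact (2 * m) :: nat) = m + multiplicity 2 (fact m :: nat)"
proof (induction m)
  case (Suc m)
  have D: "multiplicity 2 (x * y) = multiplicity 2 x + multiplicity 2 y"
    if "x \<noteq> 0" "y \<noteq> 0" for x y :: nat
    using that by (subst prime_elem_multiplicity_mult_distrib) auto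
  have "multiplicity 2 (fact (2 * Suc m) :: nat)
      = multiplicity 2 (2 * (Suc m * ((2 * m + 1) * (fact (2 * m)))) :: nat)"
    by (simp add: algebra_simps)
  also have "\<dots> = 1 + (multiplicity 2 (Suc m) + (multiplicity 2 (2 * m + 1) + multiplicity 2 (fact (2 * m) :: nat)))"
    by (subst D, simp, simp, subst D, simp, simp, subst D, simp, simp, simp)
  also have "multiplicity 2 (2 * m + 1) = 0"
    by (rule not_dvd_imp_multiplicity_0) presburger
  also have "multiplicity 2 (fact (Suc m) :: nat) = multiplicity 2 (Suc m) + multiplicity 2 (fact m :: nat)"
    by (simp only: fact_Suc of_nat_id, subst prime_elem_multiplicity_mult_distrib) auto
  ultimately show ?case using Suc by simp
qed simp

lemma multiplicity_two_fact_double_Suc: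
  "multiplicity 2 (fact (2 * m + 1) :: nat) = m + multiplicity 2 (fact m :: nat)"
proof -
  have "multiplicity 2 (fact (2 * m + 1) :: nat) = multiplicity 2 (2 * m + 1) + multiplicity 2 (fact (2 * m) :: nat)"
    by (simp only: fact_Suc of_nat_id Suc_eq_plus1 [symmetric], subst prime_elem_multiplicity_mult_distrib) auto
  moreover have "multiplicity 2 (2 * m + 1) = 0"
    by (rule not_dvd_imp_multiplicity_0) presburger
  ultimately show ?thesis by (simp add: multiplicity_two_fact_double)
qed

text \<open>One halving step of Legendre's formula at p = 2; both bounds below follow from it by
  strong induction.\<close>

lemma multiplicity_two_fact:
  "multiplicity 2 (fact n :: nat) = n div 2 + multiplicity 2 (fact (n div 2) :: nat)"
proof (cases "even n")
  case True
  then show ?thesis using multiplicity_two_fact_double[of "n div 2"] by simp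
next
  case False
  then show ?thesis using multiplicity_two_fact_double_Suc[of "n div 2"] by simp
qed

lemma multiplicity_two_fact_le: "multiplicity 2 (fact n :: nat) \<le> n"
proof (induction n rule: less_induct)
  case (less n)
  show ?case
  proof (cases "n = 0")
    case False
    then have "multiplicity 2 (fact (n div 2) :: nat) \<le> n div 2" by (intro less) auto
    then show ?thesis by (subst multiplicity_two_fact) linarith
  qed simp
qed

text \<open>Each halving loses at most 1, and log 2 (n div 2) + 1 \<le> log 2 n pays for it.\<close>

lemma le_multiplicity_two_fact:
  assumes "n \<ge> 1"
  shows "real n \<le> multiplicity 2 (fact n :: nat) + log 2 n + 1"
  using assms
proof (induction n rule: less_induct)
  case (less n)
  show ?case
  proof (cases "n = 1")
    case False
    with less.prems have m: "n div 2 < n" "n div 2 \<ge> 1" by auto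
    have n2: "real n \<le> 2 * real (n div 2) + 1" "2 * real (n div 2) \<le> real n" by linarith+
    have "1 + log 2 (n div 2) = log 2 (2 * real (n div 2))"
      using m by (subst log_mult) auto
    also have "\<dots> \<le> log 2 n" using n2 m by (subst log_le_cancel_iff) auto
    finally have "1 + log 2 (n div 2) \<le> log 2 n" .
    with less.IH[OF m] n2 multiplicity_two_fact[of n] show ?thesis by simp
  qed simp
qed

subsection \<open>Products of factorials with bounded entries\<close>

lemma fact_le_fact_mult_power:
  assumes "b \<le> a" "a \<le> M"
  shows "(fact a :: nat) \<le> fact b * M ^ (a - b)"
  using assms
proof (induction a rule: dec_induct)
  case (step a)
  then have "fact (Suc a) = Suc a * (fact a :: nat)" by simp
  also have "\<dots> \<le> M * (fact b * M ^ (a - b))" using step by (intro mult_mono) auto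
  finally show ?case using step by (simp add: Suc_diff_le algebra_simps)
qed simp

lemma fact_mult_power_le_fact:
  assumes "M \<le> a"
  shows "fact M * M ^ (a - M) \<le> (fact a :: nat)"
  using assms
proof (induction a rule: dec_induct)
  case (step a)
  have "fact M * M ^ (Suc a - M) = M * (fact M * M ^ (a - M))" using step by (simp add: Suc_diff_le)
  also have "\<dots> \<le> Suc a * fact a" using step by (intro mult_mono) auto
  finally show ?case by simp
qed simp

lemma fact_mult_le_fact_add: "fact a * fact b \<le> (fact (a + b) :: nat)"
  by (rule dvd_imp_le[OF fact_fact_dvd_fact]) simp

text \<open>The product has \<open>sum a I\<close> factors in total: \<open>y\<close> of them fit
  under \<open>fact y\<close>, and every other one is at most \<open>M\<close>. Keeping
  \<open>y\<close> free allows matching it against a lower bound for another factorial.\<close>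

lemma prod_fact_le_fact_mult_power:
  fixes a :: "'a \<Rightarrow> nat"
  assumes "finite I" "\<And>l. l \<in> I \<Longrightarrow> a l \<le> M" "y \<le> M" "y \<le> sum a I"
  shows "(\<Prod>l\<in>I. fact (a l)) \<le> fact y * M ^ (sum a I - y)"
  using assms
proof (induction I arbitrary: y rule: finite_induct)
  case (insert x F)
  show ?case
  proof (cases "y \<le> sum a F")
    case True
    have "(\<Prod>l\<in>insert x F. fact (a l)) = fact (a x) * (\<Prod>l\<in>F. fact (a l))"
      using insert by simp
    also have "\<dots> \<le> M ^ a x * (fact y * M ^ (sum a F - y))"
      using fact_le_fact_mult_power[of 0 "a x" M] insert True by (intro mult_mono insert.IH) auto
    also have "\<dots> = fact y * M ^ (a x + (sum a F - y))" by (simp add: power_add)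
    also have "a x + (sum a F - y) = sum a (insert x F) - y" using True insert by simp
    finally show ?thesis .
  next
    case False
    \<comment> \<open>\<open>F\<close> supplies only \<open>sum a F\<close> of the \<open>y\<close>
      factors; the first \<open>b\<close> factors of \<open>fact (a x)\<close> supply the
      rest.\<close>
    define b where "b = y - sum a F"
    have b: "y = b + sum a F" "b \<le> a x" using False insert by (auto simp: b_def)
    have "(\<Prod>l\<in>insert x F. fact (a l)) = fact (a x) * (\<Prod>l\<in>F. fact (a l))"
      using insert by simp
    also have "\<dots> \<le> (fact b * M ^ (a x - b)) * (fact (sum a F) * M ^ (sum a F - sum a F))"
      using fact_le_fact_mult_power[of b "a x" M] insert b by (intro mult_mono insert.IH) auto
    also have "\<dots> = (fact b * fact (sum a F)) * M ^ (a x - b)" by simp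
    also have "\<dots> \<le> fact y * M ^ (a x - b)"
      unfolding b(1) by (intro mult_right_mono fact_mult_le_fact_add) auto
    also have "a x - b = sum a (insert x F) - y" using insert b by simp
    finally show ?thesis .
  qed
qed simp

lemma fact_add_eq_prod: "fact (M + k) = fact M * (\<Prod>j\<in>{1..k}. M + j :: nat)"
  by (induction k) (simp_all add: algebra_simps)

text \<open>After cancelling \<open>fact M\<close>, the shifted product times n! equals the product
  of the a_l!. These have total size at most n + k + s and entries at most M, so they exceed n! by
  at most k + s factors \<open>M\<close>.\<close>

lemma prod_shifted_le_power:
  fixes a :: "'a \<Rightarrow> nat"
  assumes "finite I" "\<And>l. l \<in> I \<Longrightarrow> a l \<le> M" "M \<ge> 1" "k \<ge> 1"
    and eq: "fact M * (\<Prod>l\<in>I. fact (a l)) = (fact (M + k) * fact n :: nat)"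
    and S: "sum a I \<le> n + k + s"
  shows "(\<Prod>j\<in>{1..k}. M + j) \<le> M ^ (k + s)"
proof -
  define P where "P = (\<Prod>j\<in>{1..k}. M + j)"
  \<comment> \<open>The factors of n! beyond \<open>M\<close> are larger than \<open>M\<close>, so
    n! is at least \<open>fact y * M ^ (n - y)\<close>.\<close>
  define y where "y = min n M"
  have eq': "(\<Prod>l\<in>I. fact (a l)) = P * fact n"
    using eq unfolding fact_add_eq_prod P_def by simp
  have "M + k \<le> P" using assms(3,4) unfolding P_def
    by (intro dvd_imp_le dvd_prodI) (auto intro!: prod_pos)
  then have P: "P > 1" using assms(3,4) by linarith
  show ?thesis
  proof (cases "sum a I < y")
    \<comment> \<open>Here the product of the a_l! is at most n!, contradicting P > 1.\<close>
    case True
    then have "(\<Prod>l\<in>I. fact (a l)) \<le> fact (sum a I) * M ^ (sum a I - sum a I)"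
      using assms by (intro prod_fact_le_fact_mult_power) (auto simp: y_def)
    also have "\<dots> \<le> (fact n :: nat)" using True by (auto intro!: fact_mono simp: y_def)
    finally show ?thesis using P eq' by simp
  next
    case False
    have "fact y * M ^ (n - y) \<le> (fact n :: nat)"
      using fact_mult_power_le_fact[of M n] by (cases "n \<le> M") (auto simp: y_def min_def)
    then have "P * (fact y * M ^ (n - y)) \<le> P * fact n" by simp
    also have "\<dots> \<le> fact y * M ^ (sum a I - y)"
      unfolding eq'[symmetric] using assms False
      by (intro prod_fact_le_fact_mult_power) (auto simp: y_def)
    also have "\<dots> \<le> fact y * M ^ ((k + s) + (n - y))"
      using assms by (intro mult_left_mono power_increasing) (auto simp: y_def)
    finally have "P * M ^ (n - y) \<le> M ^ (k + s) * M ^ (n - y)"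
      by (simp add: power_add)
    then show ?thesis using assms(3) by (simp add: P_def)
  qed
qed

text \<open>In logarithms, M + j exceeds M by at least j / (M + k). The sum over j is at least k^2 /
  (2 (M + k)), and the \<open>s\<close> surplus factors \<open>M\<close> must cover it.\<close>

lemma square_le_of_prod_shifted_le_power:
  fixes M k s :: nat
  assumes "M \<ge> 1" and le: "(\<Prod>j\<in>{1..k}. M + j) \<le> M ^ (k + s)"
  shows "real k ^ 2 \<le> 2 * (M + k) * s * ln M"
proof -
  have "(\<Sum>j\<in>{1..k}. real j / (M + k)) \<le> (\<Sum>j\<in>{1..k}. ln (M + j) - ln M)"
  proof (rule sum_mono)
    fix j assume j: "j \<in> {1..k}"
    have "ln (real M / (M + j)) \<le> real M / (M + j) - 1"
      using assms by (intro ln_le_minus_one) auto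
    also have "\<dots> = - (j / (M + j))" using assms by (simp add: field_simps)
    also have "\<dots> \<le> - (j / (M + k))" using j assms by (simp add: frac_le)
    finally show "real j / (M + k) \<le> ln (M + j) - ln M"
      using assms by (simp add: ln_div)
  qed
  also have "\<dots> = ln (\<Prod>j\<in>{1..k}. real (M + j)) - k * ln M"
    using assms by (subst ln_prod) (auto simp: sum_subtractf)
  also have "\<dots> \<le> ln (real M ^ (k + s)) - k * ln M"
  proof -
    have "(\<Prod>j\<in>{1..k}. real (M + j)) \<le> real M ^ (k + s)"
      using le by (metis of_nat_le_iff of_nat_power of_nat_prod)
    moreover have "(\<Prod>j\<in>{1..k}. real (M + j)) > 0" using assms by (intro prod_pos) auto
    ultimately show ?thesis using assms by (simp add: ln_le_cancel_iff)
  qed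
  also have "\<dots> = s * ln M" using assms by (simp add: ln_realpow algebra_simps)
  finally have "(\<Sum>j\<in>{1..k}. real j) / (M + k) \<le> s * ln M"
    by (simp add: sum_divide_distrib)
  moreover have "(\<Sum>j\<in>{1..k}. real j) = k * (k + 1) / 2"
    by (induction k) (auto simp: field_simps)
  ultimately have "real k * (k + 1) \<le> 2 * (M + k) * s * ln M"
    using assms by (simp add: field_simps)
  moreover have "real k ^ 2 \<le> real k * (k + 1)" by (simp add: power2_eq_square mult_left_mono)
  ultimately show ?thesis by linarith
qed

subsection \<open>Prime powers in binomial coefficients\<close>

lemma Suc_div_eq: "Suc n div q = n div q + (if q dvd Suc n then 1 else 0)" for n q :: nat
  
  using div_Suc[of n q] by (simp only: dvd_eq_mod_eq_0) simp

lemma div_add_le_Suc: "(a + b) div q \<le> a div q + b div q + 1" for a b q :: nat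
proof (cases "q = 0")
  case False
  then have "a mod q + b mod q < 2 * q" by (simp add: mult_2 add_strict_mono)
  then have "(a mod q + b mod q) div q < 2" by (simp add: less_mult_imp_div_less)
  then show ?thesis by (subst div_add1_eq) simp
qed simp

lemma multiplicity_eq_card_dvd:
  fixes p x :: nat
  assumes "prime p" "x > 0" "x \<le> N"
  shows "multiplicity p x = card {i \<in> {1..N}. p ^ i dvd x}"
proof -
  have "multiplicity p x < N + 1"
  proof -
    have "multiplicity p x < p ^ multiplicity p x"
      using prime_gt_1_nat[OF assms(1)] by (intro power_gt_expt) auto
    also have "\<dots> \<le> x" using assms by (intro dvd_imp_le multiplicity_dvd) auto
    finally show ?thesis using assms by simp
  qed
  moreover have "p ^ i dvd x \<longleftrightarrow> i \<le> multiplicity p x" for i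
    using assms prime_gt_1_nat[OF assms(1)] by (intro power_dvd_iff_le_multiplicity) auto
  ultimately have "i \<in> {i \<in> {1..N}. p ^ i dvd x} \<longleftrightarrow> i \<in> {1..multiplicity p x}" for i
    unfolding mem_Collect_eq atLeastAtMost_iff by (metis Suc_eq_plus1 less_Suc_eq_le order_trans)
  then have "{i \<in> {1..N}. p ^ i dvd x} = {1..multiplicity p x}" by (rule set_eqI)
  then show ?thesis by simp
qed

text \<open>Passing from n to n + 1 raises n div p^i exactly when p^i divides n + 1. The cut-off
  \<open>N\<close> is free so that sums for different factorials can be compared term by
  term.\<close>

lemma legendre_multiplicity_fact:
  fixes p n :: nat
  assumes "prime p" "n \<le> N"
  shows "multiplicity p (fact n :: nat) = (\<Sum>i\<in>{1..N}. n div p ^ i)"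
  using assms(2)
proof (induction n)
  case (Suc n)
  have "multiplicity p (fact (Suc n) :: nat) = multiplicity p (Suc n) + multiplicity p (fact n :: nat)"
    using assms by (simp only: fact_Suc of_nat_id, subst prime_elem_multiplicity_mult_distrib) auto
  also have "multiplicity p (Suc n) = card {i \<in> {1..N}. p ^ i dvd Suc n}"
    using assms Suc by (intro multiplicity_eq_card_dvd) auto
  also have "\<dots> = (\<Sum>i\<in>{1..N}. if p ^ i dvd Suc n then 1 else 0)"
    by (simp add: sum.If_cases Int_def conj_commute)
  also have "\<dots> + multiplicity p (fact n :: nat) = (\<Sum>i\<in>{1..N}. Suc n div p ^ i)"
    using Suc prime_gt_0_nat[OF assms(1)] by (simp add: sum.distrib[symmetric] Suc_div_eq add.commute)
  finally show ?case .
qed simp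

text \<open>In Legendre's sums, index i adds at most 1 to the exponent e, and only if p^i \<le> n.
  If p^e > n, all such i are below e, which leaves too few of them.\<close>

lemma prime_power_multiplicity_binomial_le:
  fixes p n k :: nat
  assumes p: "prime p" and "k \<le> n" "n > 0"
  shows "p ^ multiplicity p (n choose k) \<le> n"
proof (rule ccontr)
  define e where "e = multiplicity p (n choose k)"
  assume "\<not> ?thesis"
  then have e: "p ^ e > n" by (simp add: e_def)
  have "(\<Sum>i\<in>{1..n}. n div p ^ i) = multiplicity p (fact k * fact (n - k) * (n choose k))"
    using legendre_multiplicity_fact[OF p order.refl, of n] binomial_fact_lemma[OF assms(2)] by simp
  also have "\<dots> = multiplicity p (fact k :: nat) + multiplicity p (fact (n - k) :: nat) + e"
    using p assms by (simp add: prime_elem_multiplicity_mult_distrib e_def)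
  also have "\<dots> = (\<Sum>i\<in>{1..n}. k div p ^ i + (n - k) div p ^ i) + e"
    using legendre_multiplicity_fact[OF p, of k n] legendre_multiplicity_fact[OF p, of "n - k" n] assms
    by (simp add: sum.distrib)
  finally have eq: "(\<Sum>i\<in>{1..n}. n div p ^ i) = (\<Sum>i\<in>{1..n}. k div p ^ i + (n - k) div p ^ i) + e" .
  have "(\<Sum>i\<in>{1..n}. n div p ^ i) \<le>
    (\<Sum>i\<in>{1..n}. (k div p ^ i + (n - k) div p ^ i) + (if p ^ i \<le> n then 1 else 0))"
  proof (rule sum_mono)
    fix i
    define q where "q = p ^ i"
    have "n div q \<le> k div q + (n - k) div q + 1" using div_add_le_Suc[of k "n - k" q] assms by simp
    then show "n div p ^ i \<le> (k div p ^ i + (n - k) div p ^ i) + (if p ^ i \<le> n then 1 else 0)"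
      by (auto simp: q_def[symmetric])
  qed
  also have "\<dots> = (\<Sum>i\<in>{1..n}. k div p ^ i + (n - k) div p ^ i) + card {i \<in> {1..n}. p ^ i \<le> n}"
    by (subst sum.distrib) (simp add: sum.If_cases Int_def conj_commute)
  finally have "e \<le> card {i \<in> {1..n}. p ^ i \<le> n}" using eq by simp
  also have "{i \<in> {1..n}. p ^ i \<le> n} \<subseteq> {1..<e}"
  proof safe
    fix i assume i: "i \<in> {1..n}" "p ^ i \<le> n"
    then have "p ^ i < p ^ e" using e by simp
    then show "i \<in> {1..<e}" using i prime_gt_1_nat[OF p] power_strict_increasing_iff by auto
  qed
  then have "card {i \<in> {1..n}. p ^ i \<le> n} \<le> card {1..<e}" by (intro card_mono) auto
  \<comment> \<open>Subtraction is truncated, so \<open>e = 0\<close> survives; then p^e = 1 > n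
    contradicts n > 0.\<close>
  finally have "e \<le> e - 1" by simp
  then have "e = 0" by simp
  with e assms show False by simp
qed

lemma binomial_le_power_card:
  fixes n k :: nat
  assumes "k \<le> n" "n > 0" "finite P" "prime_factors (n choose k) \<subseteq> P"
  shows "(n choose k) \<le> n ^ card P"
proof -
  have "(n choose k) = (\<Prod>p\<in>prime_factors (n choose k). p ^ multiplicity p (n choose k))"
    using assms prod_prime_factors[of "n choose k"] by simp
  also have "\<dots> \<le> (\<Prod>p\<in>prime_factors (n choose k). n)"
    using assms by (intro prod_mono conjI prime_power_multiplicity_binomial_le) auto
  also have "\<dots> = n ^ card (prime_factors (n choose k))" by simp
  also have "\<dots> \<le> n ^ card P" using assms by (intro power_increasing card_mono) auto
  finally show ?thesis .
qed

subsection \<open>Chebyshev bounds\<close>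

lemma prod_primes_dvd:
  fixes x :: nat
  assumes "finite P" "\<And>p. p \<in> P \<Longrightarrow> prime p" "\<And>p. p \<in> P \<Longrightarrow> p dvd x"
  shows "\<Prod>P dvd x"
  using assms
proof (induction P rule: finite_induct)
  case (insert p P)
  have "coprime p (\<Prod>P)" using insert by (intro prod_coprime_right primes_coprime) auto
  with insert show ?case by (simp add: divides_mult)
qed simp

text \<open>Erdos's induction: an even n > 2 is not prime, and for n = 2m + 1 the primes in (m + 1,
  n] all divide \<open>n choose m\<close>, which is at most 4^m.\<close>

lemma primorial_le: "\<Prod>{p. prime p \<and> p \<le> n} \<le> (4::nat) ^ n"
proof (induction n rule: less_induct)
  case (less n)
  consider "n \<le> 1" | "n = 2" | "n > 2" "even n" | "n > 2" "odd n" by (atomize_elim, cases "even n", auto)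
  then show ?case
  proof cases
    case 1
    then have "{p. prime p \<and> p \<le> n} = {}" by (auto dest: prime_gt_1_nat)
    then show ?thesis by (simp only: prod.empty) simp
  next
    case 2
    have "prime p \<and> p \<le> 2 \<longleftrightarrow> p = 2" for p :: nat
      using prime_ge_2_nat[of p] by (cases "p = 2") auto
    then show ?thesis by (simp add: 2)
  next
    case 3
    then have "\<not> prime n" using prime_odd_nat by auto
    have "p \<le> n \<longleftrightarrow> p \<le> n - 1" if "prime p" for p
    proof -
      have "p \<noteq> n" using that \<open>\<not> prime n\<close> by auto
      then show ?thesis by linarith
    qed
    then have "{p. prime p \<and> p \<le> n} = {p. prime p \<and> p \<le> n - 1}" by blast
    then have "\<Prod>{p. prime p \<and> p \<le> n} \<le> 4 ^ (n - 1)" using less[of "n - 1"] 3 by simp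
    also have "\<dots> \<le> 4 ^ n" by (intro power_increasing) auto
    finally show ?thesis .
  next
    case 4
    then obtain m where m: "n = 2 * m + 1" by (elim oddE)
    define P where "P = {p. prime p \<and> m + 1 < p \<and> p \<le> n}"
    have eq: "{p. prime p \<and> p \<le> n} = {p. prime p \<and> p \<le> m + 1} \<union> P"
      using m 4 by (auto simp: P_def)
    have fin: "finite {p. prime p \<and> p \<le> m + 1}" "finite P" by (auto simp: P_def)
    have "\<Prod>P dvd (n choose m)"
    proof (rule prod_primes_dvd)
      fix p assume p: "p \<in> P"
      then have "p dvd fact n" by (auto simp: P_def prime_dvd_fact_iff)
      also have "fact n = fact m * fact (m + 1) * (n choose m)"
        using binomial_fact_lemma[of m n] m by simp
      finally show "p dvd (n choose m)"
        using p by (auto simp: P_def prime_dvd_mult_iff prime_dvd_fact_iff simp del: fact_Suc)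
    qed (use fin in \<open>auto simp: P_def\<close>)
    then have "\<Prod>P \<le> (n choose m)" using m by (intro dvd_imp_le) auto
    also have "2 * (n choose m) \<le> 2 * 4 ^ m"
    proof -
      \<comment> \<open>The two middle coefficients are equal and both occur in the row sum 2^(2m +
        1).\<close>
      have "2 * (n choose m) = (n choose m) + (n choose (m + 1))"
        using binomial_symmetric[of m n] m by simp
      also have "\<dots> = (\<Sum>j\<in>{m, m + 1}. n choose j)" by simp
      also have "\<dots> \<le> (\<Sum>j\<le>n. n choose j)" using m by (intro sum_mono2) auto
      also have "\<dots> = 2 * 4 ^ m" unfolding choose_row_sum m by (simp add: power_mult)
      finally show ?thesis .
    qed
    finally have "\<Prod>P \<le> 4 ^ m" by simp
    moreover have "\<Prod>{p. prime p \<and> p \<le> m + 1} \<le> 4 ^ (m + 1)" using 4 m by (intro less) auto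
    ultimately have "\<Prod>{p. prime p \<and> p \<le> m + 1} * \<Prod>P \<le> 4 ^ (m + 1) * 4 ^ m"
      by (intro mult_mono) auto
    moreover have "\<Prod>{p. prime p \<and> p \<le> n} = \<Prod>{p. prime p \<and> p \<le> m + 1} * \<Prod>P"
      unfolding eq using fin by (intro prod.union_disjoint) (auto simp: P_def)
    ultimately show ?thesis using m by (simp add: power_add mult_2)
  qed
qed

text \<open>Split at sqrt A: at most sqrt A primes lie below, and those above have product at most
  4^A although each exceeds sqrt A.\<close>

lemma card_primes_le:
  assumes "A \<ge> (2::nat)"
  shows "real (card {p. prime p \<and> p \<le> A}) \<le> sqrt A + 2 * A * ln 4 / ln A"
proof -
  define Q where "Q = {p. prime p \<and> p \<le> A \<and> sqrt A < real p}"
  have fin: "finite Q" by (auto simp: Q_def)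
  have "sqrt A ^ card Q = (\<Prod>p\<in>Q. sqrt A)" by simp
  also have "\<dots> \<le> (\<Prod>p\<in>Q. real p)" by (intro prod_mono) (auto simp: Q_def)
  also have "\<dots> = real (\<Prod>Q)" by simp
  also have "\<Prod>Q \<le> \<Prod>{p. prime p \<and> p \<le> A}"
    by (intro dvd_imp_le prod_dvd_prod_subset prod_pos) (auto simp: Q_def prime_gt_0_nat)
  also have "\<dots> \<le> 4 ^ A" by (rule primorial_le)
  finally have "sqrt A ^ card Q \<le> 4 ^ A" by simp
  then have "ln (sqrt A ^ card Q) \<le> ln (4 ^ A)" using assms by (subst ln_le_cancel_iff) auto
  then have "card Q * (ln A / 2) \<le> A * ln 4" using assms by (simp add: ln_realpow ln_sqrt)
  then have Q: "card Q \<le> 2 * A * ln 4 / ln A" using assms by (simp add: field_simps)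
  have "{p. prime p \<and> p \<le> A} \<subseteq> {1..nat \<lfloor>sqrt A\<rfloor>} \<union> Q"
    using prime_ge_1_nat by (fastforce simp: Q_def not_less intro: le_nat_floor)
  then have "card {p. prime p \<and> p \<le> A} \<le> card ({1..nat \<lfloor>sqrt A\<rfloor>} \<union> Q)"
    using fin by (intro card_mono) auto
  also have "\<dots> \<le> nat \<lfloor>sqrt A\<rfloor> + card Q" using card_Un_le[of "{1..nat \<lfloor>sqrt A\<rfloor>}" Q] by simp
  finally have "real (card {p. prime p \<and> p \<le> A}) \<le> real (nat \<lfloor>sqrt A\<rfloor>) + card Q" by linarith
  also have "real (nat \<lfloor>sqrt A\<rfloor>) \<le> sqrt A" by simp
  finally show ?thesis using Q by simp
qed

lemma eventually_card_primes_le: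
  assumes "\<epsilon> > 0"
  shows "eventually (\<lambda>A. real (card {p. prime p \<and> p \<le> A}) \<le> \<epsilon> * real A) at_top"
proof -
  have "eventually (\<lambda>A::nat. sqrt A + 2 * A * ln 4 / ln A \<le> \<epsilon> * real A) at_top"
    using assms by real_asymp
  then show ?thesis using eventually_ge_at_top[of 2]
    by eventually_elim (use card_primes_le in \<open>force intro: order.trans\<close>)
qed

subsection \<open>Radicals of consecutive integers\<close>

text \<open>The induction proves an exact count: multiples of \<open>p\<close> up to m + k are those
  up to m and those in the run.\<close>

lemma card_dvd_shifted_le:
  fixes m k p :: nat
  shows "card {i \<in> {..<k}. p dvd Suc m + i} \<le> k div p + 1"
proof -
  have "m div p + card {i \<in> {..<k}. p dvd Suc m + i} = (m + k) div p"
  proof (induction k)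
    case (Suc k)
    have "{i \<in> {..<Suc k}. p dvd Suc m + i} = {i \<in> {..<k}. p dvd Suc m + i} \<union> (if p dvd Suc m + k then {k} else {})"
      by (auto simp: less_Suc_eq)
    also have "card \<dots> = card {i \<in> {..<k}. p dvd Suc m + i} + (if p dvd Suc (m + k) then 1 else 0)"
      by (subst card_Un_disjoint) auto
    finally show ?case using Suc Suc_div_eq[of "m + k" p] by simp
  qed simp
  with div_add_le_Suc[of m k p] show ?thesis by linarith
qed

text \<open>\<open>k div p\<close> is the first term of Legendre's sum for k!; primes above
  \<open>k\<close> contribute the factor 1.\<close>

lemma prod_prime_power_div_le_fact:
  fixes k :: nat
  assumes "finite P" "\<And>p. p \<in> P \<Longrightarrow> prime p"
  shows "(\<Prod>p\<in>P. p ^ (k div p)) \<le> (fact k :: nat)"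
proof -
  define Q where "Q = P \<inter> {p. p \<le> k}"
  have "(\<Prod>p\<in>P. p ^ (k div p)) = (\<Prod>p\<in>Q. p ^ (k div p))"
    using assms(1) by (intro prod.mono_neutral_right) (auto simp: Q_def not_le)
  also have "\<dots> \<le> (\<Prod>p\<in>Q. p ^ multiplicity p (fact k :: nat))"
  proof (intro prod_mono conjI power_increasing)
    fix p assume p: "p \<in> Q"
    then have pp: "prime p" "k \<ge> 1" using assms prime_ge_1_nat[of p] by (auto simp: Q_def)
    then show "1 \<le> p" using prime_ge_1_nat by auto
    have "k div p = (\<Sum>i\<in>{1}. k div p ^ i)" by simp
    also have "\<dots> \<le> (\<Sum>i\<in>{1..k}. k div p ^ i)" using pp by (intro sum_mono2) auto
    finally show "k div p \<le> multiplicity p (fact k :: nat)"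
      by (simp only: legendre_multiplicity_fact[OF pp(1) order.refl])
  qed auto
  also have "\<dots> \<le> (\<Prod>p\<in>prime_factors (fact k :: nat). p ^ multiplicity p (fact k :: nat))"
  proof (intro dvd_imp_le prod_dvd_prod_subset prod_pos)
    show "Q \<subseteq> prime_factors (fact k :: nat)"
      using assms by (auto simp: Q_def in_prime_factors_iff prime_dvd_fact_iff)
  qed (auto simp: in_prime_factors_iff prime_gt_0_nat)
  also have "\<dots> = fact k" using prod_prime_factors[of "fact k :: nat"] by simp
  finally show ?thesis .
qed

lemma rad_int: "rad (int x) = int (\<Prod>(prime_factors x))"
proof -
  have "prime_factors (int x) = int ` prime_factors x"
  proof (intro set_eqI iffI)
    fix q assume q: "q \<in> prime_factors (int x)"
    then have "q \<ge> 0" using in_prime_factors_imp_prime prime_ge_0_int by blast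
    then obtain p where "q = int p" using nonneg_int_cases by blast
    with q show "q \<in> int ` prime_factors x" by (auto simp: in_prime_factors_iff)
  qed (auto simp: in_prime_factors_iff)
  then show ?thesis unfolding rad_def by (simp add: prod.reindex)
qed

text \<open>The abc triple is 1 + x = x + 1; the term 1 adds no prime to the radical.\<close>

lemma explicit_abc_consecutive:
  assumes explicit_abc "x \<ge> 1"
  shows "real (x + 1) < real (\<Prod>(prime_factors (x * (x + 1)))) powr (7 / 4)"
proof -
  have "coprime (int x) (int x + 1)" by simp
  then have "real_of_int (int x + 1) < real_of_int (rad (1 * int x * (int x + 1))) powr (7 / 4)"
    using assms(1)[unfolded explicit_abc_def, rule_format, of 1 "int x" "int x + 1"] assms(2) by simp
  also have "1 * int x * (int x + 1) = int (x * (x + 1))" by (simp add: algebra_simps)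
  finally show ?thesis unfolding rad_int by simp
qed

lemma prod_lessThan_double: "(\<Prod>j<h. f (2 * j) * f (2 * j + 1)) = (\<Prod>i<2 * h. f i)"
  for f :: "nat \<Rightarrow> 'a :: comm_monoid_mult"
  by (induction h) (auto simp: mult.assoc)

text \<open>Exchange the products: p \<le> A occurs once per multiple in the run, at most k div p +
  1 times. The powers p^(k div p) multiply to at most k!, the extra factors p to the
  primorial.\<close>

lemma prod_radicals_consecutive_le:
  fixes m k A :: nat
  assumes m: "m \<ge> 1" and smooth: "\<And>i. i < k \<Longrightarrow> prime_factors (m + i) \<subseteq> {..A}"
  shows "(\<Prod>i<k. \<Prod>(prime_factors (m + i))) \<le> fact k * 4 ^ A"
proof -
  define P where "P = {p. prime p \<and> p \<le> A}"
  have P: "finite P" "\<And>p. p \<in> P \<Longrightarrow> prime p" by (auto simp: P_def)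
  have "(\<Prod>i<k. \<Prod>(prime_factors (m + i))) = (\<Prod>i<k. \<Prod>p\<in>P. if p dvd m + i then p else 1)"
  proof (rule prod.cong[OF refl])
    fix i assume "i \<in> {..<k}"
    then have "prime_factors (m + i) = {p \<in> P. p dvd m + i}"
      using smooth[of i] m by (auto simp: in_prime_factors_iff P_def subset_eq)
    then show "\<Prod>(prime_factors (m + i)) = (\<Prod>p\<in>P. if p dvd m + i then p else 1)"
      using P(1) by (simp add: prod.inter_filter)
  qed
  also have "\<dots> = (\<Prod>p\<in>P. \<Prod>i<k. if p dvd m + i then p else 1)" by (rule prod.swap)
  also have "\<dots> = (\<Prod>p\<in>P. p ^ card {i \<in> {..<k}. p dvd m + i})"
    by (intro prod.cong refl, subst prod.inter_filter[symmetric]) auto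
  also have "\<dots> \<le> (\<Prod>p\<in>P. p ^ (k div p + 1))"
    using card_dvd_shifted_le[where m = "m - 1" and k = k] m P(2)[THEN prime_ge_1_nat]
    by (intro prod_mono conjI power_increasing) auto
  also have "\<dots> = (\<Prod>p\<in>P. p ^ (k div p)) * \<Prod>P" by (simp add: prod.distrib mult.commute)
  also have "\<dots> \<le> fact k * 4 ^ A"
    using prod_prime_power_div_le_fact[OF P] primorial_le[of A] by (intro mult_mono) (auto simp: P_def)
  finally show ?thesis .
qed

text \<open>Add the logarithmic abc bounds for the disjoint pairs (m + 2j, m + 2j + 1). Neighbours
  are coprime, so the radical of a pair is a product of two radicals.\<close>

lemma explicit_abc_smooth_run:
  fixes m k A :: nat
  assumes abc: explicit_abc
    and m: "m \<ge> 1" and smooth: "\<And>i. i < k \<Longrightarrow> prime_factors (m + i) \<subseteq> {..A}"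
  shows "(k div 2) * ln m \<le> 7 / 4 * (k * ln k + A * ln 4)"
proof (cases "k = 0")
  case False
  define h where "h = k div 2"
  define r where "r = (\<lambda>i. \<Prod>(prime_factors (m + i)))"
  have r_pos: "r i \<ge> 1" for i
    unfolding r_def by (metis One_nat_def Suc_leI in_prime_factors_imp_prime prime_gt_0_nat prod_pos)
  have "h * ln m = (\<Sum>j<h. ln m)" by simp
  also have "\<dots> \<le> (\<Sum>j<h. 7 / 4 * ln (r (2 * j) * r (2 * j + 1)))"
  proof (rule sum_mono)
    fix j
    define x where "x = m + 2 * j"
    have x: "x \<ge> 1" using m by (simp add: x_def)
    have "\<Prod>(prime_factors (x * (x + 1))) = r (2 * j) * r (2 * j + 1)"
    proof -
      have "prime_factors (x * (x + 1)) = prime_factors x \<union> prime_factors (x + 1)"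
        using x by (intro prime_factors_product) auto
      moreover have "prime_factors x \<inter> prime_factors (x + 1) = {}"
      proof -
        have "\<not> prime p" if "p dvd x" "p dvd x + 1" for p
          using that by (metis dvd_add_right_iff nat_dvd_1_iff_1 not_prime_1)
        then show ?thesis unfolding in_prime_factors_iff disjoint_iff by blast
      qed
      ultimately show ?thesis
        by (simp add: prod.union_disjoint r_def x_def add.assoc)
    qed
    with explicit_abc_consecutive[OF abc x]
    have "real (x + 1) < real (r (2 * j) * r (2 * j + 1)) powr (7 / 4)" by (simp only:)
    then have "real m \<le> real (r (2 * j) * r (2 * j + 1)) powr (7 / 4)" by (simp add: x_def)
    then have "ln (real m) \<le> ln (real (r (2 * j) * r (2 * j + 1)) powr (7 / 4))"
      using m by (intro ln_mono) auto
    also have "\<dots> = 7 / 4 * ln (real (r (2 * j) * r (2 * j + 1)))"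
      using r_pos[of "2 * j"] r_pos[of "2 * j + 1"] by (subst ln_powr) auto
    finally show "ln (real m) \<le> 7 / 4 * ln (real (r (2 * j) * r (2 * j + 1)))" .
  qed
  also have "\<dots> = 7 / 4 * ln (\<Prod>j<h. real (r (2 * j) * r (2 * j + 1)))"
    using r_pos by (subst ln_prod) (auto simp: sum_distrib_left Suc_le_eq)
  also have "(\<Prod>j<h. real (r (2 * j) * r (2 * j + 1))) = real (\<Prod>i<2 * h. r i)"
    by (subst prod_lessThan_double[symmetric]) simp
  also have "ln (real (\<Prod>i<2 * h. r i)) \<le> ln (real k ^ k * 4 ^ A)"
  proof (rule ln_mono)
    show "0 < real (\<Prod>i<2 * h. r i)" using r_pos by (simp add: prod_pos Suc_le_eq)
    \<comment> \<open>For odd \<open>k\<close> the last integer is unpaired; including its radical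
      only enlarges the product.\<close>
    have "(\<Prod>i<2 * h. r i) dvd (\<Prod>i<k. r i)"
      by (intro prod_dvd_prod_subset) (auto simp: h_def)
    then have "(\<Prod>i<2 * h. r i) \<le> (\<Prod>i<k. r i)"
      using r_pos by (intro dvd_imp_le prod_pos) (auto simp: Suc_le_eq)
    also have "\<dots> \<le> fact k * 4 ^ A"
      unfolding r_def by (rule prod_radicals_consecutive_le[OF m smooth])
    also have "\<dots> \<le> k ^ k * 4 ^ A" using fact_le_power[of k, where 'a = nat] by (intro mult_right_mono) auto
    finally have "real (\<Prod>i<2 * h. r i) \<le> real (k ^ k * 4 ^ A)" by (simp only: of_nat_le_iff)
    then show "real (\<Prod>i<2 * h. r i) \<le> real k ^ k * 4 ^ A" by simp
  qed
  also have "ln (real k ^ k * 4 ^ A) = k * ln k + A * ln 4"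
    using False by (simp add: ln_mult ln_realpow)
  finally show ?thesis by (simp add: h_def)
qed simp

subsection \<open>Solutions give smooth runs\<close>

text \<open>A weak Stirling bound; the induction step amounts to n ln (1 + 1/n) \<le> 1.\<close>

lemma ln_fact_ge: "real n * ln n - n \<le> ln (fact n)"
proof (induction n)
  case (Suc n)
  have "n * ln (1 + 1 / real n) \<le> 1"
  proof (cases "n = 0")
    case False
    then have "ln (1 + 1 / real n) \<le> 1 / real n" by (intro ln_add_one_self_le_self) auto
    with False show ?thesis by (simp add: field_simps)
  qed simp
  moreover have "n * ln (1 + 1 / real n) = n * ln (Suc n) - n * ln n"
  proof (cases "n = 0")
    case False
    then have "1 + 1 / real n = real (Suc n) / n" by (simp add: field_simps)
    with False show ?thesis by (simp add: ln_div right_diff_distrib)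
  qed simp
  moreover have "ln (fact (Suc n)) = ln (Suc n) + ln (fact n)" by (simp add: ln_mult)
  ultimately show ?case using Suc by (simp add: algebra_simps)
qed simp

lemma is_solution_antimono:
  assumes "is_solution t a n1 n2" "l \<le> l'" "l' < t"
  shows "a ! l' \<le> a ! l"
  using assms(2,3)
proof (induction l' rule: dec_induct)
  case (step j)
  have "a ! Suc j \<le> a ! (Suc j - 1)"
    using assms(1) step.prems unfolding is_solution_def by force
  with step show ?case by simp
qed simp

text \<open>Compare 2-adic valuations: the right side has at most n1 + n2, and each a_l! falls short
  of a_l by at most log 2 n1 + 1.\<close>

lemma is_solution_sum_le:
  assumes sol: "is_solution t a n1 n2" and le: "a ! 0 \<le> n1"
  shows "real (\<Sum>l<t. a ! l) \<le> real n1 + real n2 + t * (log 2 n1 + 1)"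
proof -
  have a: "1 \<le> a ! l" "a ! l \<le> n1" if "l < t" for l
  proof -
    have "2 \<le> a ! (t - 1)" using sol by (simp add: is_solution_def)
    also have "\<dots> \<le> a ! l" using that by (intro is_solution_antimono[OF sol]) auto
    finally show "1 \<le> a ! l" by simp
    show "a ! l \<le> n1" using is_solution_antimono[OF sol, of 0 l] le that by simp
  qed
  define v where "v = (\<lambda>n. multiplicity 2 (fact n :: nat))"
  have "(\<Sum>l<t. v (a ! l)) = multiplicity 2 (\<Prod>l<t. fact (a ! l) :: nat)"
    unfolding v_def by (subst prime_elem_multiplicity_prod_distrib) auto
  also have "\<dots> = multiplicity 2 (fact n1 * fact n2 :: nat)"
    using sol unfolding is_solution_def by simp
  also have "\<dots> = v n1 + v n2"
    unfolding v_def by (subst prime_elem_multiplicity_mult_distrib) auto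
  also have "\<dots> \<le> n1 + n2"
    unfolding v_def by (intro add_mono multiplicity_two_fact_le)
  finally have v: "(\<Sum>l<t. v (a ! l)) \<le> n1 + n2" .
  have "real (\<Sum>l<t. a ! l) = (\<Sum>l<t. real (a ! l))" by simp
  also have "\<dots> \<le> (\<Sum>l<t. v (a ! l) + (log 2 n1 + 1))"
  proof (rule sum_mono)
    fix l assume "l \<in> {..<t}"
    then have l: "1 \<le> a ! l" "a ! l \<le> n1" using a by auto
    have "log 2 (a ! l) \<le> log 2 n1" using l by (subst log_le_cancel_iff) auto
    with le_multiplicity_two_fact[OF l(1)] show "real (a ! l) \<le> v (a ! l) + (log 2 n1 + 1)"
      unfolding v_def by linarith
  qed
  also have "\<dots> = real (\<Sum>l<t. v (a ! l)) + t * (log 2 n1 + 1)" by (simp add: sum.distrib)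
  also have "real (\<Sum>l<t. v (a ! l)) \<le> real n1 + real n2" using v by linarith
  finally show ?thesis by simp
qed

lemma prod_shifted_le: "(\<Prod>j\<in>{1..k}. M + j) \<le> (n::nat) ^ k" if "M + k \<le> n"
proof -
  have "(\<Prod>j\<in>{1..k}. M + j) \<le> (\<Prod>j\<in>{1..k}. n)" using that by (intro prod_mono) auto
  then show ?thesis by simp
qed

text \<open>Reduces a solution to data on the run of \<open>k\<close> integers ending at
  \<open>n1\<close>; the last three facts let \<open>n1\<close> bound the whole tuple.\<close>

lemma Nset_smooth_run:
  assumes N: "(a, n1, n2) \<in> Nset t c i" and i: "i \<in> {2..t}" and t: "t \<ge> 3"
  obtains k A where "2 \<le> k" "k < n1"
    "real k ^ 2 \<le> 2 * real n1 * (t * (log 2 n1 + 1) + 1) * ln n1"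
    "\<And>x. n1 - k < x \<Longrightarrow> x \<le> n1 \<Longrightarrow> prime_factors x \<subseteq> {..A}"
    "fact A \<le> n1 ^ ((1 + c) * k)"
    "set a \<subseteq> {..n1}" "length a = t" "n2 \<le> n1"
proof -
  define M where "M = a ! 0"
  define k where "k = n1 - M"
  define b where "b = a ! (i - 1)"
  define k2 where "k2 = n2 - b"
  \<comment> \<open>The positions left after cancelling a_1! and a_i!; lists start at 0, so a_i sits
    at i - 1.\<close>
  define I where "I = {..<t} - {0} - {i - 1}"
  define A where "A = Max ((!) a ` I)"
  have sol: "is_solution t a n1 n2" and nontriv: "nontrivial t a n1 n2"
    and n1: "n1 = M + k" "k > 0" and n2: "n2 = b + k2" and ratio: "real k2 / real k \<le> c"
    using N by (auto simp: Nset_def M_def k_def b_def k2_def)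
  have len: "length a = t" and "n2 \<le> n1"
    and eq: "(\<Prod>l<t. fact (a ! l)) = (fact n1 * fact n2 :: nat)"
    using sol by (auto simp: is_solution_def)
  have aM: "a ! l \<le> M" if "l < t" for l
    using is_solution_antimono[OF sol, of 0 l] that by (simp add: M_def)
  have "M \<ge> 2"
    using is_solution_antimono[OF sol, of 0 "t - 1"] sol t by (simp add: M_def is_solution_def)
  \<comment> \<open>A gap of 1 would make the solution trivial; \<open>k \<ge> 2\<close> guarantees
    a pair for abc.\<close>
  have "k \<noteq> 1" using nontriv t n1 unfolding nontrivial_def M_def by force
  with n1 have k: "k \<ge> 2" by simp
  have k2: "k2 \<le> c * k"
  proof -
    have "real k2 \<le> real (c * k)" using ratio n1(2) by (simp add: field_simps)
    then show ?thesis by linarith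
  qed
  have idx: "0 \<in> {..<t}" "i - 1 \<in> {..<t} - {0}" using i t by auto
  have eqJ: "fact M * (\<Prod>l\<in>{..<t} - {0}. fact (a ! l)) = (fact (M + k) * fact n2 :: nat)"
    using eq prod.remove[OF finite_lessThan idx(1), of "\<lambda>l. fact (a ! l) :: nat"]
    by (simp add: M_def flip: n1(1)[unfolded M_def])
  define \<Delta>1 where "\<Delta>1 = (\<Prod>j\<in>{1..k}. M + j)"
  define \<Delta>2 where "\<Delta>2 = (\<Prod>j\<in>{1..k2}. b + j)"
  have eqI: "(\<Prod>l\<in>I. fact (a ! l)) = \<Delta>1 * \<Delta>2"
  proof -
    have "(\<Prod>l\<in>{..<t} - {0}. fact (a ! l) :: nat) = fact b * (\<Prod>l\<in>I. fact (a ! l))"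
      unfolding I_def b_def by (rule prod.remove[OF _ idx(2)]) simp
    with eqJ have "fact M * (fact b * (\<Prod>l\<in>I. fact (a ! l))) = (fact (M + k) * fact (b + k2) :: nat)"
      by (simp add: n2)
    also have "\<dots> = fact M * (fact b * (\<Delta>1 * \<Delta>2))"
      unfolding fact_add_eq_prod \<Delta>1_def \<Delta>2_def by (simp add: mult_ac)
    finally show ?thesis by simp
  qed
  have fin: "finite I" by (simp add: I_def)
  have "I \<noteq> {}"
  proof -
    \<comment> \<open>As t \<ge> 3, position 1 or 2 survives, so the maximum defining
      \<open>A\<close> is attained.\<close>
    have "(if i = 2 then 2 else 1) \<in> I" using i t by (auto simp: I_def)
    then show ?thesis by blast
  qed
  have "real k ^ 2 \<le> 2 * real n1 * (t * (log 2 n1 + 1) + 1) * ln n1"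
  proof -
    \<comment> \<open>The surplus must be an integer exponent; rounding up costs the final
      \<open>+ 1\<close> in the bound.\<close>
    define s where "s = nat \<lceil>t * (log 2 n1 + 1)\<rceil>"
    have log: "log 2 n1 \<ge> 0" using n1 \<open>M \<ge> 2\<close> by simp
    have s: "t * (log 2 n1 + 1) \<le> s" by (simp add: s_def real_nat_ceiling_ge)
    have s': "s \<le> t * (log 2 n1 + 1) + 1" using log by (simp add: s_def of_nat_nat ceiling_correct)
    have "(\<Sum>l<t. a ! l) = M + (\<Sum>l\<in>{..<t} - {0}. a ! l)"
      unfolding M_def by (rule sum.remove[OF _ idx(1)]) simp
    with is_solution_sum_le[OF sol] s n1
    have "real (\<Sum>l\<in>{..<t} - {0}. a ! l) \<le> real (n2 + k + s)" by (simp add: M_def)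
    then have S: "(\<Sum>l\<in>{..<t} - {0}. a ! l) \<le> n2 + k + s" by linarith
    have "(\<Prod>j\<in>{1..k}. M + j) \<le> M ^ (k + s)"
      using \<open>M \<ge> 2\<close> k by (intro prod_shifted_le_power[OF _ _ _ _ eqJ S]) (auto intro: aM)
    then have "real k ^ 2 \<le> 2 * (M + k) * s * ln M"
      using \<open>M \<ge> 2\<close> by (intro square_le_of_prod_shifted_le_power) auto
    also have "\<dots> \<le> (2 * real n1 * (t * (log 2 n1 + 1) + 1)) * ln n1"
      using \<open>M \<ge> 2\<close> n1(1) s' by (intro mult_mono) auto
    finally show ?thesis by simp
  qed
  moreover have "prime_factors x \<subseteq> {..A}" if x: "n1 - k < x" "x \<le> n1" for x
  proof
    fix p assume "p \<in> prime_factors x"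
    then have p: "prime p" "p dvd x" by auto
    \<comment> \<open>\<open>x\<close> is a factor of \<open>\<Delta>1\<close>, so each of its
      primes divides some remaining a_l! and is at most A.\<close>
    have "x = M + (x - M)" "x - M \<in> {1..k}" using x n1 by auto
    then have "x dvd \<Delta>1" unfolding \<Delta>1_def by (metis dvd_prodI finite_atLeastAtMost)
    with p have "p dvd (\<Prod>l\<in>I. fact (a ! l))" unfolding eqI by (meson dvd_mult2 dvd_trans)
    then obtain l where "l \<in> I" "p dvd fact (a ! l)"
      using p fin by (auto simp: prime_dvd_prod_iff)
    then have "p \<le> a ! l" using p by (simp add: prime_dvd_fact_iff)
    also have "\<dots> \<le> A" unfolding A_def using fin \<open>l \<in> I\<close> by (intro Max_ge) auto
    finally show "p \<in> {..A}" by simp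
  qed
  moreover have "fact A \<le> n1 ^ ((1 + c) * k)"
  proof -
    have "A \<in> (!) a ` I" unfolding A_def using fin \<open>I \<noteq> {}\<close> by (intro Max_in) auto
    then obtain l where l: "l \<in> I" "A = a ! l" by auto
    have "fact A \<le> (\<Prod>l\<in>I. fact (a ! l) :: nat)"
      unfolding l(2) using fin l(1) by (intro dvd_imp_le dvd_prodI prod_pos) auto
    \<comment> \<open>All factors of \<open>\<Delta>1\<close> and \<open>\<Delta>2\<close> are at
      most n1; the ratio hypothesis then enters as k2 \<le> c k.\<close>
    also have "\<dots> \<le> n1 ^ k * n1 ^ k2"
      unfolding eqI \<Delta>1_def \<Delta>2_def using n1 n2 \<open>n2 \<le> n1\<close> by (intro mult_mono prod_shifted_le) auto
    also have "\<dots> = n1 ^ (k + k2)" by (simp add: power_add)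
    also have "\<dots> \<le> n1 ^ ((1 + c) * k)" using n1 k2 by (intro power_increasing) auto
    finally show ?thesis .
  qed
  moreover have "set a \<subseteq> {..n1}"
  proof
    fix x assume "x \<in> set a"
    then obtain l where "l < t" "x = a ! l" using len by (auto simp: in_set_conv_nth)
    with aM[of l] n1 show "x \<in> {..n1}" by simp
  qed
  moreover have "k < n1" using n1 \<open>M \<ge> 2\<close> by simp
  ultimately show ?thesis using that k len \<open>n2 \<le> n1\<close> by blast
qed

subsection \<open>Boundedness of smooth runs\<close>

text \<open>By \<open>lnk\<close>, n/k is at least n^(1/4), so (n/k)^k \<le> (n choose k) \<le>
  n^\<pi>(A) yields k/4 \<le> \<pi>(A).\<close>

lemma smooth_run_length_le:
  fixes n k A :: nat
  assumes n: "n \<ge> 2" and k: "1 \<le> k" "k \<le> n" and lnk: "ln k \<le> 3 / 4 * ln n"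
    and smooth: "\<And>x. n - k < x \<Longrightarrow> x \<le> n \<Longrightarrow> prime_factors x \<subseteq> {..A}"
  shows "k \<le> 4 * card {p. prime p \<and> p \<le> A}"
proof -
  define \<pi> where "\<pi> = card {p. prime p \<and> p \<le> A}"
  have "prime_factors (n choose k) \<subseteq> {p. prime p \<and> p \<le> A}"
  proof safe
    fix p assume "p \<in> prime_factors (n choose k)"
    then have p: "prime p" "p dvd (n choose k)" by auto
    then show "prime p" by simp
    have "fact (n - k) * (fact k * (n choose k)) = (fact (n - k + k) :: nat)"
      using binomial_fact_lemma[OF k(2)] k by (simp add: mult_ac)
    also have "\<dots> = fact (n - k) * (\<Prod>j\<in>{1..k}. n - k + j)" by (rule fact_add_eq_prod)
    finally have "fact k * (n choose k) = (\<Prod>j\<in>{1..k}. n - k + j)" by simp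
    with p have "p dvd (\<Prod>j\<in>{1..k}. n - k + j)" by (metis dvd_mult)
    then obtain j where j: "j \<in> {1..k}" "p dvd n - k + j"
      using p(1) by (auto simp: prime_dvd_prod_iff)
    then have "p \<in> prime_factors (n - k + j)" using p(1) by (auto simp: in_prime_factors_iff)
    moreover have "prime_factors (n - k + j) \<subseteq> {..A}" using j k by (intro smooth) auto
    ultimately show "p \<le> A" by auto
  qed
  then have "(n choose k) \<le> n ^ \<pi>"
    unfolding \<pi>_def using n k by (intro binomial_le_power_card) auto
  then have "real (n choose k) \<le> real n ^ \<pi>" by (metis of_nat_le_iff of_nat_power)
  with binomial_ge_n_over_k_pow_k[OF k(2), where 'a = real]
  have "(real n / real k) ^ k \<le> real n ^ \<pi>" by linarith
  then have "ln ((real n / real k) ^ k) \<le> ln (real n ^ \<pi>)"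
    using n k by (intro ln_mono) auto
  then have "k * (ln n - ln k) \<le> \<pi> * ln n" using n k by (simp add: ln_realpow ln_div)
  moreover have "k * (1 / 4 * ln n) \<le> k * (ln n - ln k)" using lnk by (intro mult_left_mono) auto
  ultimately have "(real k / 4) * ln n \<le> \<pi> * ln n" by simp
  then have "real k / 4 \<le> \<pi>" using n by (simp add: mult_le_cancel_right)
  then show ?thesis unfolding \<pi>_def by linarith
qed

text \<open>For short runs the \<open>k * ln k\<close> term of the abc bound is a small multiple of
  k ln n and can be absorbed on the left.\<close>

lemma explicit_abc_short_smooth_run:
  fixes n k A :: nat
  assumes abc: explicit_abc
    and n: "n \<ge> 2" and k: "2 \<le> k" "k \<le> n" and lnk: "ln k \<le> 1 / 32 * ln n"
    and kn: "real k + sqrt n \<le> n"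
    and smooth: "\<And>x. n - k < x \<Longrightarrow> x \<le> n \<Longrightarrow> prime_factors x \<subseteq> {..A}"
  shows "k * ln n \<le> 48 * real A"
proof -
  define m where "m = n - k + 1"
  have "real k / 3 \<le> k div 2"
  proof -
    have "k \<le> 3 * (k div 2)" using k by linarith
    then show ?thesis by linarith
  qed
  moreover have "ln n / 2 \<le> ln m"
  proof -
    have "sqrt n \<le> m" using kn k by (simp add: m_def of_nat_diff)
    then have "ln (sqrt n) \<le> ln m" using n by (intro ln_mono) auto
    then show ?thesis using n by (simp add: ln_sqrt)
  qed
  ultimately have "(real k / 3) * (ln n / 2) \<le> (k div 2) * ln m"
    using n by (intro mult_mono) auto
  also have "\<dots> \<le> 7 / 4 * (k * ln k + A * ln 4)"
  proof (rule explicit_abc_smooth_run[OF abc])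
    fix i assume "i < k"
    then show "prime_factors (m + i) \<subseteq> {..A}" using k by (intro smooth) (auto simp: m_def)
  qed (simp add: m_def)
  also have "\<dots> \<le> 7 / 4 * (k * (1 / 32 * ln n) + A * 3)"
  proof -
    have "ln 4 \<le> (3::real)" using ln_le_minus_one[of "4::real"] by simp
    then show ?thesis using lnk by (intro mult_left_mono add_mono) (auto intro: mult_left_mono)
  qed
  \<comment> \<open>1/6 - 7/128 = 43/384, so the resulting constant is 2016/43 < 48.\<close>
  finally have "(1 / 6) * (k * ln n) \<le> 7 / 128 * (k * ln n) + 21 / 4 * A" by simp
  then show ?thesis by linarith
qed

text \<open>Since 9 \<ge> e^2, ln A \<ge> 2, and the loss A in Stirling's bound is at most half of A
  ln A.\<close>

lemma ln_fact_ge_half: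
  assumes "A \<ge> 9"
  shows "real A * (ln A / 2) \<le> ln (fact A)"
proof -
  have "exp (2::real) = exp 1 ^ 2" by (simp flip: exp_of_nat_mult)
  also have "\<dots> \<le> (3::real) ^ 2" using exp_le by (intro power_mono) auto
  finally have "exp (2::real) \<le> 9" by simp
  then have "exp 2 \<le> real A" using assms by linarith
  then have "2 \<le> ln A" using assms by (subst ln_ge_iff) auto
  then have "real A * (ln A / 2) \<le> real A * (ln A - 1)" by (intro mult_left_mono) auto
  also have "\<dots> \<le> ln (fact A)" using ln_fact_ge[of A] by (simp add: algebra_simps)
  finally show ?thesis .
qed

lemma explicit_abc_smooth_run_bounded:
  fixes t c :: nat
  assumes abc: explicit_abc and t: "t > 0"
  obtains N where "\<And>n k A. \<lbrakk>2 \<le> k; k < n;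
      real k ^ 2 \<le> 2 * real n * (t * (log 2 n + 1) + 1) * ln n;
      \<And>x. n - k < x \<Longrightarrow> x \<le> n \<Longrightarrow> prime_factors x \<subseteq> {..A};
      fact A \<le> n ^ ((1 + c) * k)\<rbrakk> \<Longrightarrow> n \<le> N"
proof -
  define T where "T = real t"
  have "T > 0" using t by (simp add: T_def)
  then have "\<forall>\<^sub>F n::nat in at_top. 2 * real n * (T * (log 2 n + 1) + 1) * ln n \<le> n powr (3 / 2)"
    by real_asymp
  moreover have "\<forall>\<^sub>F n::nat in at_top. real n powr (3 / 4) + sqrt n \<le> n" by real_asymp
  ultimately have "\<forall>\<^sub>F n::nat in at_top. 2 * real n * (T * (log 2 n + 1) + 1) * ln n \<le> n powr (3 / 2)
      \<and> real n powr (3 / 4) + sqrt n \<le> n"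
    by (rule eventually_conj)
  then obtain N1 where N1: "2 * real n * (T * (log 2 n + 1) + 1) * ln n \<le> n powr (3 / 2)"
      "real n powr (3 / 4) + sqrt n \<le> n" if "n \<ge> N1" for n :: nat
    unfolding eventually_at_top_linorder by blast
  \<comment> \<open>Chosen so that (1 + c) 4 \<epsilon> = 1/64, which later gives ln A \<le> (ln n)
    / 32.\<close>
  define \<epsilon> where "\<epsilon> = 1 / (256 * (1 + real c))"
  have \<epsilon>: "\<epsilon> > 0" "4 * \<epsilon> \<le> 1" "(1 + real c) * (4 * \<epsilon>) = 1 / 64"
    by (simp_all add: \<epsilon>_def field_simps)
  obtain A0 where A0: "real (card {p. prime p \<and> p \<le> A}) \<le> \<epsilon> * A" if "A \<ge> A0" for A :: nat
    using eventually_card_primes_le[OF \<epsilon>(1)] unfolding eventually_at_top_linorder by blast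
  \<comment> \<open>\<open>A1\<close> separates small from large A, and \<open>B\<close> will bound
    A. In \<open>N\<close>, \<open>N1\<close> serves the asymptotics, \<open>(4 * A1) ^ 32\<close>
    the case of small A, and exp (48 B) the final contradiction.\<close>
  define A1 where "A1 = max A0 9"
  define B where "B = max 9 (exp (96 * (1 + real c)))"
  define N where "N = max (max N1 ((4 * A1) ^ 32)) (nat \<lceil>exp (48 * B)\<rceil>)"
  show ?thesis
  proof (rule that[of N], rule ccontr)
    fix n k A :: nat
    assume k: "2 \<le> k" "k < n"
      and sq: "real k ^ 2 \<le> 2 * real n * (t * (log 2 n + 1) + 1) * ln n"
      and smooth: "\<And>x. n - k < x \<Longrightarrow> x \<le> n \<Longrightarrow> prime_factors x \<subseteq> {..A}"
      and factA: "fact A \<le> n ^ ((1 + c) * k)"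
      and "\<not> n \<le> N"
    then have "n \<ge> N1" "n \<ge> (4 * A1) ^ 32" and nN: "n > N" by (auto simp: N_def)
    have lnn: "ln n > 0" using k by simp
    define \<pi> where "\<pi> = card {p. prime p \<and> p \<le> A}"
    have k34: "real k \<le> n powr (3 / 4)"
    proof (rule power2_le_imp_le)
      have "real k ^ 2 \<le> n powr (3 / 2)" using sq N1(1)[OF \<open>n \<ge> N1\<close>] by (simp add: T_def)
      also have "\<dots> = (n powr (3 / 4)) ^ 2" using k by (simp add: powr_power)
      finally show "real k ^ 2 \<le> (n powr (3 / 4)) ^ 2" .
    qed simp
    then have "ln k \<le> ln (n powr (3 / 4))" using k by (intro ln_mono) auto
    then have lnk: "ln k \<le> 3 / 4 * ln n" using k by (simp add: ln_powr)
    have k\<pi>: "k \<le> 4 * \<pi>"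
      unfolding \<pi>_def using k lnk by (intro smooth_run_length_le[OF _ _ _ _ smooth]) auto
    have lnA: "real A * (ln A / 2) \<le> (1 + real c) * (k * ln n)" if "A \<ge> 9"
    proof -
      have "real (fact A) \<le> real (n ^ ((1 + c) * k))" using factA by (simp only: of_nat_le_iff)
      then have "ln (fact A) \<le> ln (real n ^ ((1 + c) * k))" by (intro ln_mono) auto
      also have "\<dots> = (1 + real c) * (k * ln n)" using k by (simp add: ln_realpow algebra_simps)
      finally show ?thesis using ln_fact_ge_half[OF that] by linarith
    qed
    have short: "ln k \<le> 1 / 32 * ln n"
    proof (cases "A < A1")
      case True
      \<comment> \<open>For small A the trivial bound \<pi>(A) \<le> A already bounds k by a
        constant.\<close>
      have "\<pi> \<le> card {1..A}"
        unfolding \<pi>_def by (intro card_mono) (auto dest: prime_ge_1_nat)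
      with k\<pi> True have "k \<le> 4 * A1" by simp
      then have "k ^ 32 \<le> (4 * A1) ^ 32" by (intro power_mono) auto
      also have "\<dots> \<le> n" by fact
      finally have "real k ^ 32 \<le> n" by (metis of_nat_le_iff of_nat_power)
      then have "ln (real k ^ 32) \<le> ln n" using k by (intro ln_mono) auto
      then show ?thesis using k by (simp add: ln_realpow)
    next
      case False
      then have A: "A \<ge> A0" "A \<ge> 9" by (auto simp: A1_def)
      have "real k \<le> 4 * \<pi>" using k\<pi> by linarith
      also have "\<dots> \<le> 4 * (\<epsilon> * A)" using A0[OF A(1)] by (simp add: \<pi>_def)
      finally have k_le: "real k \<le> 4 * \<epsilon> * A" by simp
      \<comment> \<open>Inserting k \<le> 4 \<epsilon> A allows A to be cancelled, leaving ln A
        \<le> (ln n) / 32; then k \<le> A carries this over to k.\<close>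
      have "real A * (ln A / 2) \<le> (1 + real c) * (k * ln n)" using lnA A by simp
      also have "\<dots> \<le> (1 + real c) * (4 * \<epsilon> * A * ln n)"
        using k_le lnn by (intro mult_left_mono mult_right_mono) auto
      also have "\<dots> = ((1 + real c) * (4 * \<epsilon>)) * (A * ln n)" by simp
      also have "\<dots> = real A * (ln n / 64)" unfolding \<epsilon>(3) by simp
      finally have "ln A / 2 \<le> ln n / 64" using A(2) by (subst (asm) mult_le_cancel_left_pos) auto
      moreover have "4 * \<epsilon> * A \<le> 1 * real A" using \<epsilon>(2) by (intro mult_right_mono) auto
      with k_le have "real k \<le> A" by linarith
      then have "ln k \<le> ln A" using k by (intro ln_mono) auto
      ultimately show ?thesis by simp
    qed
    have "real k + sqrt n \<le> n" using k34 N1(2)[OF \<open>n \<ge> N1\<close>] by linarith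
    then have kA: "k * ln n \<le> 48 * real A"
      using k short by (intro explicit_abc_short_smooth_run[OF abc _ _ _ _ _ smooth]) auto
    have "A \<le> B"
    proof (cases "A \<ge> 9")
      case True
      have "real A * (ln A / 2) \<le> (1 + real c) * (k * ln n)" by (rule lnA[OF True])
      \<comment> \<open>The abc bound replaces k ln n by a multiple of A, so cancelling A bounds ln
        A.\<close>
      also have "\<dots> \<le> (1 + real c) * (48 * real A)" using kA by (intro mult_left_mono) auto
      also have "\<dots> = real A * (48 * (1 + real c))" by simp
      finally have "ln A / 2 \<le> 48 * (1 + real c)" using True by (subst (asm) mult_le_cancel_left_pos) auto
      then have "ln A \<le> 96 * (1 + real c)" by simp
      then have "exp (ln A) \<le> exp (96 * (1 + real c))" by (simp only: exp_le_cancel_iff)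
      then have "A \<le> exp (96 * (1 + real c))" using True by simp
      then show ?thesis by (simp add: B_def)
    qed (simp add: B_def)
    have "1 * ln n \<le> k * ln n" using k lnn by (intro mult_right_mono) auto
    then have "ln n \<le> 48 * B" using kA \<open>A \<le> B\<close> by linarith
    then have "exp (ln n) \<le> exp (48 * B)" by (simp only: exp_le_cancel_iff)
    then have "n \<le> exp (48 * B)" using k by simp
    moreover have "exp (48 * B) \<le> N" unfolding N_def by linarith
    ultimately show False using nN by linarith
  qed
qed

theorem theorem1p1:
  fixes t c :: nat
  assumes abc: explicit_abc
    and t3: "t \<ge> 3"
    and cpos: "c > 0"
  shows "(\<forall>i\<in>{2..t}. finite (Nset t c i)) \<and> finite (\<Union>i\<in>{2..t}. Nset t c i)"
proof -
  have "t > 0" using t3 by simp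
  obtain N where N: "\<And>n k A. \<lbrakk>2 \<le> k; k < n;
      real k ^ 2 \<le> 2 * real n * (t * (log 2 n + 1) + 1) * ln n;
      \<And>x. n - k < x \<Longrightarrow> x \<le> n \<Longrightarrow> prime_factors x \<subseteq> {..A};
      fact A \<le> n ^ ((1 + c) * k)\<rbrakk> \<Longrightarrow> n \<le> N"
    using explicit_abc_smooth_run_bounded[OF abc \<open>t > 0\<close>, of c] by blast
  \<comment> \<open>\<open>N\<close> was fixed before \<open>i\<close> and the solution; n1 \<le> N
    confines the whole tuple to a finite box.\<close>
  have fin: "finite (Nset t c i)" if i: "i \<in> {2..t}" for i
  proof (rule finite_subset)
    show "Nset t c i \<subseteq> {a. set a \<subseteq> {..N} \<and> length a = t} \<times> {..N} \<times> {..N}"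
    proof
      fix x assume "x \<in> Nset t c i"
      then obtain a n1 n2 where x: "x = (a, n1, n2)" and "(a, n1, n2) \<in> Nset t c i"
        by (metis prod_cases3)
      from Nset_smooth_run[OF this(2) i t3] obtain k A where
        kA: "2 \<le> k" "k < n1" "real k ^ 2 \<le> 2 * real n1 * (t * (log 2 n1 + 1) + 1) * ln n1"
          "\<And>x. n1 - k < x \<Longrightarrow> x \<le> n1 \<Longrightarrow> prime_factors x \<subseteq> {..A}"
          "fact A \<le> n1 ^ ((1 + c) * k)"
        and rest: "set a \<subseteq> {..n1}" "length a = t" "n2 \<le> n1"
        by metis
      have "n1 \<le> N" by (rule N[OF kA])
      with rest show "x \<in> {a. set a \<subseteq> {..N} \<and> length a = t} \<times> {..N} \<times> {..N}"
        unfolding x by auto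
    qed
    show "finite ({a. set a \<subseteq> {..N} \<and> length a = t} \<times> {..N} \<times> {..N})"
      by (intro finite_cartesian_product finite_lists_length_eq) auto
  qed
  then show ?thesis by auto
qed

end
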